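(* Let $R$ be a finite ring with unity and let $r\in R$. The $r$-noncommuting graph $\Gamma_R^r$ is a tree if and only if $|R|=2$ and $r\neq 0$.
   Context: Rings are associative. $[x,y]:=xy-yx$. The $r$-noncommuting graph $\Gamma_R^r$ is the simple undirected graph with vertex set $R$ in which two distinct vertices $x,y$ are adjacent if and only if $[x,y]\neq r$ and $[x,y]\neq -r$. *)

theory Defs
  imports "Graph_Theory.Graph_Theory" "HOL-Library.Cardinality"
begin

definition ring_commutator :: "'a::ring \<Rightarrow> 'a \<Rightarrow> 'a"
  where "ring_commutator x y = x * y - y * x"

text \<open>Following Graph_Theory, an undirected edge between x and y is the pair of opposite
  arcs (x, y) and (y, x).\<close>

definition r_noncommuting_graph :: "'a::ring \<Rightarrow> 'a pair_pre_digraph"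
  where "r_noncommuting_graph r =
    \<lparr> pverts = UNIV,
      parcs = {(x, y). x \<noteq> y \<and> ring_commutator x y \<noteq> r \<and> ring_commutator x y \<noteq> - r} \<rparr>"

lemma pair_bidirected_digraph_r_noncommuting_graph:
  "pair_bidirected_digraph (r_noncommuting_graph r)"
proof
  fix e assume e: "e \<in> parcs (r_noncommuting_graph r)"
  show "fst e \<in> pverts (r_noncommuting_graph r)" "snd e \<in> pverts (r_noncommuting_graph r)"
    by (simp_all add: r_noncommuting_graph_def)
  show "fst e \<noteq> snd e"
    using e by (auto simp: r_noncommuting_graph_def)
next
  have flip: "ring_commutator y x = s \<longleftrightarrow> ring_commutator x y = - s" for x y s :: 'a
    unfolding ring_commutator_def by (metis minus_diff_eq minus_minus)
  have "sym (parcs (r_noncommuting_graph r))"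
  proof (rule symI)
    fix x y assume "(x, y) \<in> parcs (r_noncommuting_graph r)"
    then show "(y, x) \<in> parcs (r_noncommuting_graph r)"
      using flip[of y x r] flip[of y x "- r"] by (simp add: r_noncommuting_graph_def) blast
  qed
  then show "symmetric (with_proj (r_noncommuting_graph r))"
    by (simp add: symmetric_def)
qed

text \<open>The library predicates forest and tree are about directed cycles, so they count the
  walk x, y, x along an edge and its reverse as a cycle and reject every undirected graph
  that has an edge.  A cycle of an undirected simple graph has at least three edges; in a
  symmetric loop-free digraph without parallel arcs these are exactly the directed cycles of
  length at least 3.\<close>

definition undirected_cycle :: "'a pair_pre_digraph \<Rightarrow> ('a \<times> 'a) awalk \<Rightarrow> bool"
  where "undirected_cycle G p \<longleftrightarrow> pre_digraph.cycle (with_proj G) p \<and> 3 \<le> length p"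

text \<open>The locale predicate pair_bidirected_digraph says that G is an undirected simple graph;
  connectedness includes having at least one vertex.\<close>

definition undirected_tree :: "'a pair_pre_digraph \<Rightarrow> bool"
  where "undirected_tree G \<longleftrightarrow>
    pair_bidirected_digraph G \<and> connected (with_proj G) \<and> \<not> (\<exists>p. undirected_cycle G p)"

text \<open>Rings with unity are of class ring_1, hence nontrivial.  For the zero ring the graph is a
  single vertex and therefore a tree, although the ring does not have two elements.\<close>

end

theory Submission
  imports Defs
begin

text \<open>The elements \<open>0\<close> and \<open>1\<close> are central, so every commutator
  involving them is 0. If \<open>r = 0\<close>, the vertex \<open>0\<close> is isolated, while
  \<open>1\<close> is another vertex, so the graph is disconnected. If \<open>r \<noteq> 0\<close>,
  then \<open>0\<close> and \<open>1\<close> are each adjacent to all other vertices: the graph is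
  connected, and any third element x closes a triangle \<open>0\<close>, \<open>1\<close>, x. An
  acyclic graph therefore leaves only \<open>0\<close> and \<open>1\<close>. Conversely, two
  vertices are too few for a cycle of length at least 3, by
  \<open>undirected_cycle_length_le_card\<close>.\<close>

lemma connected_r_noncommuting_graph_iff:
  fixes r :: "'a::ring_1"
  shows "connected (with_proj (r_noncommuting_graph r)) \<longleftrightarrow> r \<noteq> 0"
proof -
  interpret pair_bidirected_digraph "r_noncommuting_graph r"
    by (rule pair_bidirected_digraph_r_noncommuting_graph)
  let ?G = "with_proj (r_noncommuting_graph r)"
  \<comment> \<open>Connectedness is strong connectedness of the symmetric closure; the arcs are
    already symmetric, so plain directed reachability suffices.\<close>
  have connected_iff: "connected ?G \<longleftrightarrow> (\<forall>x y. x \<rightarrow>\<^sup>*\<^bsub>?G\<^esub> y)"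
    using reachable_mk_symmetric_eq[OF sym_arcs]
    by (simp add: connected_def strongly_connected_def) (simp add: r_noncommuting_graph_def)
  show ?thesis
  proof
    assume "connected ?G"
    then have "(0::'a) \<rightarrow>\<^sup>*\<^bsub>?G\<^esub> 1"
      by (simp add: connected_iff)
    \<comment> \<open>Since \<open>0 \<noteq> 1\<close>, the walk has a first arc out of
      \<open>0\<close>; its commutator is 0, which rules out \<open>r = 0\<close>.\<close>
    then obtain z where "(0::'a) \<rightarrow>\<^bsub>?G\<^esub> z"
      by (cases rule: converse_reachable_cases) auto
    then show "r \<noteq> 0"
      by (auto simp: r_noncommuting_graph_def ring_commutator_def)
  next
    assume r: "r \<noteq> 0"
    \<comment> \<open>The graph contains a star centred at \<open>0\<close>, through which any two
      vertices are joined.\<close>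
    have "x \<rightarrow>\<^sup>*\<^bsub>?G\<^esub> 0" "0 \<rightarrow>\<^sup>*\<^bsub>?G\<^esub> x" for x
    proof -
      have "x = 0 \<or> (x \<rightarrow>\<^bsub>?G\<^esub> 0 \<and> 0 \<rightarrow>\<^bsub>?G\<^esub> x)"
        using r by (auto simp: r_noncommuting_graph_def ring_commutator_def)
      moreover have "0 \<in> verts ?G"
        by (simp add: r_noncommuting_graph_def)
      ultimately show "x \<rightarrow>\<^sup>*\<^bsub>?G\<^esub> 0" "0 \<rightarrow>\<^sup>*\<^bsub>?G\<^esub> x"
        by (auto intro: reachable_refl reachable_adjI)
    qed
    then show "connected ?G"
      unfolding connected_iff by (blast intro: reachable_trans)
  qed
qed

text \<open>Absence of loops makes the three vertices pairwise distinct, so this closed walk repeats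
  no vertex except its start.\<close>

lemma undirected_cycle_triangle:
  assumes "pair_bidirected_digraph G"
    and "(x, y) \<in> parcs G" "(y, z) \<in> parcs G" "(z, x) \<in> parcs G"
  shows "undirected_cycle G [(x, y), (y, z), (z, x)]"
proof -
  interpret pair_bidirected_digraph G by fact
  show ?thesis
    using assms(2-) no_loops' wellformed'
    by (auto simp: undirected_cycle_def cycle_def awalk_def)
qed

text \<open>A closed walk with n arcs lists n + 1 vertices, the first equal to the last; dropping
  the first leaves n vertices, distinct on a cycle.\<close>

lemma undirected_cycle_length_le_card:
  assumes "undirected_cycle G p" "finite (pverts G)" "pair_wf_digraph G"
  shows "length p \<le> card (pverts G)"
proof -
  interpret pair_wf_digraph G by fact
  obtain u where p: "awalk u p u" "distinct (tl (awalk_verts u p))"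
    using assms(1) by (auto simp: undirected_cycle_def cycle_def)
  have "length p = card (set (tl (awalk_verts u p)))"
    using p(2) by (simp add: distinct_card length_awalk_verts)
  also have "\<dots> \<le> card (pverts G)"
    using p(1) assms(2) by (intro card_mono) (auto dest!: list.set_sel(2)[rotated] awalk_verts_in_verts)
  finally show ?thesis .
qed

theorem proposition2p3:
  fixes r :: "'a::{ring_1, finite}"
  shows "undirected_tree (r_noncommuting_graph r) \<longleftrightarrow> CARD('a) = 2 \<and> r \<noteq> 0"
proof -
  have "CARD('a) = 2" if r: "r \<noteq> 0" and acyc: "\<not> (\<exists>p. undirected_cycle (r_noncommuting_graph r) p)"
  proof -
    have "x = 0 \<or> x = 1" for x :: 'a
    proof (rule ccontr)
      assume "\<not> (x = 0 \<or> x = 1)"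
      \<comment> \<open>All three commutators along this triangle vanish, hence differ from
        \<open>r\<close> and \<open>- r\<close>.\<close>
      then have "undirected_cycle (r_noncommuting_graph r) [(0, 1), (1, x), (x, 0)]"
        using r by (intro undirected_cycle_triangle pair_bidirected_digraph_r_noncommuting_graph)
          (auto simp: r_noncommuting_graph_def ring_commutator_def)
      with acyc show False by blast
    qed
    then have "(UNIV :: 'a set) = {0, 1}" by auto
    then show ?thesis by (metis card_2_iff zero_neq_one)
  qed
  moreover have "\<not> undirected_cycle (r_noncommuting_graph r) p" if "CARD('a) = 2" for p
  proof
    assume c: "undirected_cycle (r_noncommuting_graph r) p"
    interpret pair_bidirected_digraph "r_noncommuting_graph r"
      by (rule pair_bidirected_digraph_r_noncommuting_graph)
    have "length p \<le> card (pverts (r_noncommuting_graph r))"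
      using c by (rule undirected_cycle_length_le_card) (auto simp: pair_wf_digraph_axioms)
    with c that show False
      by (simp add: r_noncommuting_graph_def undirected_cycle_def)
  qed
  ultimately show ?thesis
    by (auto simp: undirected_tree_def connected_r_noncommuting_graph_iff
        pair_bidirected_digraph_r_noncommuting_graph)
qed

end
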